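(* Let $n\ge r\ge 1$ and $r\le s<n$ be integers, let $\Omega\subset\mathbb{R}^d$ be a bounded set, and let $A(p)\in\mathbb{R}^{n\times n}$ and $b(p)\in\mathbb{R}^n$ be given for each $p\in\Omega$. Let $p_1,\ldots,p_r\in\Omega$ (the snapshot points), let $Q_X\in\mathbb{R}^{n\times r}$ have orthonormal columns, put $B(p)=A(p)Q_X$, and let $S\in\mathbb{R}^{s\times n}$ be a subsampling matrix. Assume that $A(p_i)Q_X$ has full column rank for each $i=1,\ldots,r$, and let $A(p_i)Q_X=U(p_i)H(p_i)$ be its polar decomposition. For $p_*\in\Omega$ let $$c(p_* )=\operatorname{argmin}_{c\in\mathbb{R}^r}\|B(p_* )c-b(p_* )\|_2,\qquad \hat c(p_* )=\operatorname{argmin}_{\hat c\in\mathbb{R}^r}\|S(B(p_* )\hat c-b(p_* ))\|_2 .$$ Suppose that $A(p)$ is Lipschitz continuous in $p$, that is, $\|A(p)-A(\tilde p)\|_2\le L\|p-\tilde p\|_2$ for all $p,\tilde p\in\Omega$. (1) For every $p_*\in\Omega$, $$\frac{\|B(p_* )\hat c(p_* )-b(p_* )\|_2}{\|B(p_* )c(p_* )-b(p_* )\|_2}\le\frac{1}{\sigma_{\min}(SU(p_{i\star}))-\widetilde C\widetilde\delta},$$ provided that $\sigma_{\min}(SU(p_{i\star}))>\widetilde C\widetilde\delta$, where $p_{i\star}$ is the snapshot point nearest to $p_*$, $\widetilde\delta=L\|p_*-p_{i\star}\|_2$, and $\widetilde C=\frac{3}{\sigma_{\min}(A(p_{i\star})Q_X)}$.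 (2) Suppose further that the snapshot points are taken such that $\min_i\|p-p_i\|_2\le h$ for all $p\in\Omega$. Then for every $p_*\in\Omega$, $$\frac{\|B(p_* )\hat c(p_* )-b(p_* )\|_2}{\|B(p_* )c(p_* )-b(p_* )\|_2}\le\frac{1}{\min_i\left(\sigma_{\min}(SU(p_i))\right)-\hat C\hat\delta},$$ provided that $\min_i\left(\sigma_{\min}(SU(p_i))\right)>\hat C\hat\delta$, where $\hat C=\frac{3}{\min_i\left(\sigma_{\min}(A(p_i)Q_X)\right)}$ and $\hat\delta=Lh$.
   Context: $\|\cdot\|_2$ is the operator (spectral) norm of a matrix or the Euclidean norm of a vector. For a matrix $M$ with $r$ columns and at least $r$ rows, $\sigma_{\min}(M)=\sigma_r(M)$ is its smallest ($r$-th largest) singular value. A subsampling matrix $S\in\mathbb{R}^{s\times n}$ is a row-submatrix of the identity $I_n$: it consists of $s$ distinct rows of $I_n$, so each row has exactly one entry equal to $1$ and zeros elsewhere. The polar decomposition of $B\in\mathbb{R}^{n\times r}$ ($n\ge r$) is $B=UH$ with $U\in\mathbb{R}^{n\times r}$ having orthonormal columns and $H\in\mathbb{R}^{r\times r}$ symmetric positive semidefinite; if $B$ has full column rank, it is unique. In the application, $Q_X$ is the orthonormal factor of the thin QR decomposition of the snapshot matrix $X=[x(p_1),\ldots,x(p_r)]$ with $A(p_i)x(p_i)=b(p_i)$. "Nearest" is in the Euclidean norm. A bound $\frac{x}{y}\le K$ on a ratio of residual norms is to be read as $x\le Ky$ when $y=0$ (which occurs for instance when $p_*$ is a snapshot point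 in the application). *)

theory Defs
  imports "HOL-Analysis.Analysis"
begin

text \<open>
  The library norm on \<open>real ^ 'c ^ 'm\<close> is the Frobenius norm, so the operator norm
  is written with \<^const>\<open>onorm\<close>.
\<close>

definition opnorm :: "real ^ 'c ^ 'm \<Rightarrow> real" where
  "opnorm M = onorm (\<lambda>x. M *v x)"

definition eigenvalues :: "real ^ 'k ^ 'k \<Rightarrow> real set" where
  "eigenvalues N = {l. \<exists>v. v \<noteq> 0 \<and> N *v v = l *s v}"

text \<open>
  For \<open>M\<close> with at least as many rows as columns these are exactly the \<open>CARD('c)\<close> singular
  values, as a set; multiplicities play no role for the smallest one.
\<close>

definition singular_values :: "real ^ 'c ^ 'm \<Rightarrow> real set" where
  "singular_values M = sqrt ` eigenvalues (transpose M ** M)"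

definition sigma_min :: "real ^ 'c ^ 'm \<Rightarrow> real" where
  "sigma_min M = Min (singular_values M)"

definition orthonormal_columns :: "real ^ 'c ^ 'm \<Rightarrow> bool" where
  "orthonormal_columns M \<longleftrightarrow>
     (\<forall>i j. column i M \<bullet> column j M = (if i = j then 1 else 0))"

definition subsampling_matrix :: "real ^ 'n ^ 's \<Rightarrow> bool" where
  "subsampling_matrix S \<longleftrightarrow>
     (\<exists>f. inj f \<and> (\<forall>i. row i S = row (f i) (mat 1 :: real ^ 'n ^ 'n)))"

definition symmetric_psd :: "real ^ 'k ^ 'k \<Rightarrow> bool" where
  "symmetric_psd H \<longleftrightarrow> transpose H = H \<and> (\<forall>x. 0 \<le> x \<bullet> (H *v x))"

definition polar_decomposition ::
  "real ^ 'c ^ 'm \<Rightarrow> real ^ 'c ^ 'm \<Rightarrow> real ^ 'c ^ 'c \<Rightarrow> bool" where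
  "polar_decomposition B U H \<longleftrightarrow> B = U ** H \<and> orthonormal_columns U \<and> symmetric_psd H"

text \<open>
  The bound \<open>x / y \<le> K\<close> on a ratio of residual norms. The case \<open>y = 0\<close> is
  separate because HOL has \<open>x / 0 = 0\<close>; there the bound says \<open>x \<le> K * y\<close>.
\<close>

definition ratio_le :: "real \<Rightarrow> real \<Rightarrow> real \<Rightarrow> bool" where
  "ratio_le x y K \<longleftrightarrow> (if y = 0 then x \<le> K * y else x / y \<le> K)"

end

theory Submission
  imports Defs
begin

text \<open>
  Instead of comparing the polar factor of \<open>B p\<close> with the one at the snapshot, the proof asks
  how much the sampling \<open>S\<close> can shrink vectors of the range of \<open>B p\<close>, and this can be estimated
  one vector at a time.

  Write \<open>B0 = U ** H\<close> for the snapshot matrix \<open>A (snap i) ** Q\<close>, \<open>\<sigma>\<close> for its smallest singular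
  value and \<open>m\<close> for that of \<open>S ** U\<close>. Since \<open>U\<close> is an isometry, \<open>S\<close> shrinks a vector \<open>B0 *v x\<close>
  at most by the factor \<open>m\<close>. Replacing \<open>B0\<close> by \<open>B = B p\<close>, which is within \<open>\<delta>\<close> of it, costs
  \<open>(1 + m) * \<delta> * norm x\<close>, which is at most \<open>2 * \<delta> * norm x\<close>, while
  \<open>norm (B *v x)\<close> is at least \<open>(\<sigma> - \<delta>) * norm x\<close>. The proviso of the theorem forces \<open>3 * \<delta> < \<sigma>\<close>
  because \<open>m \<le> 1\<close>, and then \<open>2 / (\<sigma> - \<delta>) \<le> 3 / \<sigma>\<close>. So \<open>S\<close> shrinks vectors of the range of \<open>B\<close>
  at most by the factor \<open>\<kappa> = m - 3 * \<delta> / \<sigma>\<close>; this is \<open>sampling_lower_bound_perturbed\<close>.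

  For the residuals, let \<open>r\<close> be the optimal residual and \<open>e\<close> the difference between the residual
  of the sampled solution and \<open>r\<close>, a vector in the range of \<open>B\<close>. Bounding \<open>norm e\<close>
  by \<open>norm r / \<kappa>\<close> and applying Pythagoras would only give the factor \<open>sqrt (1 + 1 / \<kappa>\<^sup>2)\<close>. The sharp factor \<open>1 / \<kappa>\<close> reflects the
  fact that an oblique projection and its complement have the same norm; lemma
  \<open>oblique_residual_bound\<close> extracts it from the two orthogonality relations
  \<open>e \<bullet> r = 0\<close> and \<open>(S *v e) \<bullet> (S *v (e + r)) = 0\<close>.

  Since \<^const>\<open>sigma_min\<close> is the minimum of the square roots of a set of eigenvalues, one also needs
  that this set is finite and that its least element is the minimum of the Rayleigh quotient. The bound with the
  fill distance then follows from the pointwise one by monotonicity.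
\<close>

section \<open>Minimality and orthogonality\<close>

lemma quadratic_nonneg_imp_linear_zero:
  fixes a b :: real
  assumes nonneg: "\<And>t. 0 \<le> 2 * t * a + t\<^sup>2 * b"
  shows "a = 0"
proof (rule ccontr)
  assume "a \<noteq> 0"
  define k where "k = \<bar>b\<bar> + 1"
  have "0 < k" "b < 2 * k" by (auto simp: k_def)
  have "0 \<le> 2 * (- a / k) * a + (- a / k)\<^sup>2 * b" by (rule nonneg)
  also have "\<dots> = a\<^sup>2 * (b - 2 * k) / k\<^sup>2"
    using \<open>0 < k\<close> by (simp add: field_simps power2_eq_square)
  also have "\<dots> < 0"
    using \<open>a \<noteq> 0\<close> \<open>0 < k\<close> \<open>b < 2 * k\<close> by (intro divide_neg_pos mult_pos_neg) auto
  finally show False by simp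
qed

lemma least_squares_orthogonal:
  fixes M :: "real ^ 'c ^ 'm" and b :: "real ^ 'm"
  assumes minimal: "\<And>x. norm (M *v c - b) \<le> norm (M *v x - b)"
  shows "(M *v c - b) \<bullet> (M *v x) = 0"
proof (rule quadratic_nonneg_imp_linear_zero)
  fix t :: real
  let ?r = "M *v c - b"
  have "M *v (c + t *\<^sub>R x) - b = ?r + t *\<^sub>R (M *v x)"
    by (simp add: matrix_vector_right_distrib scaleR_matrix_vector_assoc matrix_vector_mult_scaleR)
  then have "norm ?r \<le> norm (?r + t *\<^sub>R (M *v x))"
    using minimal[of "c + t *\<^sub>R x"] by metis
  then have "?r \<bullet> ?r \<le> (?r + t *\<^sub>R (M *v x)) \<bullet> (?r + t *\<^sub>R (M *v x))"
    by (simp add: norm_le)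
  then show "0 \<le> 2 * t * (?r \<bullet> (M *v x)) + t\<^sup>2 * ((M *v x) \<bullet> (M *v x))"
    by (simp add: inner_add_left inner_add_right inner_commute power2_eq_square algebra_simps)
qed

lemma inner_transpose_mult:
  fixes M :: "real ^ 'c ^ 'm"
  shows "(transpose M *v x) \<bullet> y = x \<bullet> (M *v y)"
  by (simp add: transpose_matrix_vector dot_lmul_matrix)

section \<open>The smallest singular value\<close>

text \<open>
  Eigenvectors of a symmetric matrix for different eigenvalues are orthogonal, and a pairwise
  orthogonal set is finite.
\<close>

lemma finite_eigenvalues_symmetric:
  fixes N :: "real ^ 'k ^ 'k"
  assumes sym: "transpose N = N"
  shows "finite (eigenvalues N)"
proof -
  have "\<forall>l \<in> eigenvalues N. \<exists>v. v \<noteq> 0 \<and> N *v v = l *s v"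
    by (simp add: eigenvalues_def)
  then obtain v where v: "\<And>l. l \<in> eigenvalues N \<Longrightarrow> v l \<noteq> 0 \<and> N *v v l = l *s v l"
    by (metis (no_types, lifting))
  have orth: "v l \<bullet> v l' = 0" if "l \<in> eigenvalues N" "l' \<in> eigenvalues N" "l \<noteq> l'" for l l'
  proof -
    have "(N *v v l) \<bullet> v l' = v l \<bullet> (N *v v l')"
      using inner_transpose_mult[of N "v l" "v l'"] sym by simp
    then have "(l - l') * (v l \<bullet> v l') = 0"
      using v that by (simp add: scalar_mult_eq_scaleR algebra_simps)
    then show ?thesis using that by simp
  qed
  have "inj_on v (eigenvalues N)"
  proof (rule inj_onI, rule ccontr)
    fix l l' assume *: "l \<in> eigenvalues N" "l' \<in> eigenvalues N" "v l = v l'" "l \<noteq> l'"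
    then show False using orth[of l l'] v[of l'] by simp
  qed
  moreover have "pairwise orthogonal (v ` eigenvalues N)"
    unfolding pairwise_def orthogonal_def using orth by blast
  then have "finite (v ` eigenvalues N)" by (rule pairwise_orthogonal_imp_finite)
  ultimately show ?thesis by (simp add: finite_image_iff)
qed

text \<open>
  The minimum of the Rayleigh quotient over the compact unit sphere is attained, and
  \<open>N - \<mu>\<close> is positive semidefinite with a vector \<open>v\<close> on which its quadratic form
  vanishes. Perturbing \<open>v\<close> in the direction of \<open>(N - \<mu>) v\<close> shows that \<open>v\<close> is an eigenvector.
\<close>

lemma symmetric_least_eigenvalue:
  fixes N :: "real ^ 'k ^ 'k"
  assumes sym: "transpose N = N"
  obtains \<mu> where "\<mu> \<in> eigenvalues N" and "\<And>x. \<mu> * (x \<bullet> x) \<le> x \<bullet> (N *v x)"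
proof -
  let ?q = "\<lambda>x. x \<bullet> (N *v x)"
  have "axis undefined 1 \<in> sphere (0 :: real ^ 'k) 1" by simp
  then have "sphere (0 :: real ^ 'k) 1 \<noteq> {}" by blast
  moreover have "continuous_on (sphere 0 1) ?q"
    by (intro continuous_intros linear_continuous_on matrix_vector_mul_bounded_linear)
  ultimately obtain v where v: "v \<in> sphere 0 1" and least: "\<And>y. y \<in> sphere 0 1 \<Longrightarrow> ?q v \<le> ?q y"
    using continuous_attains_inf[of "sphere (0 :: real ^ 'k) 1" ?q] compact_sphere by metis
  define \<mu> where "\<mu> = ?q v"
  have vv: "v \<bullet> v = 1" using v by (simp add: dot_square_norm)
  have rayleigh: "\<mu> * (x \<bullet> x) \<le> ?q x" for x
  proof (cases "x = 0")
    case False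
    let ?y = "(1 / norm x) *\<^sub>R x"
    have "\<mu> \<le> ?q ?y" unfolding \<mu>_def using False by (intro least) simp
    also have "?q ?y = ?q x / (x \<bullet> x)"
      by (simp add: matrix_vector_mult_scaleR dot_square_norm power2_eq_square)
    finally show ?thesis using False by (simp add: pos_le_divide_eq)
  qed simp
  define w where "w = N *v v - \<mu> *\<^sub>R v"
  have "w \<bullet> w = 0"
  proof (rule quadratic_nonneg_imp_linear_zero)
    fix t :: real
    let ?z = "v + t *\<^sub>R w"
    have "v \<bullet> (N *v w) = (N *v v) \<bullet> w"
      using inner_transpose_mult[of N v w] sym by simp
    then have q: "?q ?z = \<mu> + 2 * t * (w \<bullet> (N *v v)) + t\<^sup>2 * ?q w"
      by (simp add: \<mu>_def matrix_vector_right_distrib matrix_vector_mult_scaleR inner_add_left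
          inner_add_right inner_commute power2_eq_square algebra_simps)
    have z: "?z \<bullet> ?z = 1 + 2 * t * (w \<bullet> v) + t\<^sup>2 * (w \<bullet> w)"
      by (simp add: vv inner_add_left inner_add_right inner_commute power2_eq_square algebra_simps)
    have "w \<bullet> w = w \<bullet> (N *v v) - \<mu> * (w \<bullet> v)"
      by (subst (2) w_def) (simp add: inner_diff_right)
    then have "2 * t * (w \<bullet> w) = 2 * t * (w \<bullet> (N *v v) - \<mu> * (w \<bullet> v))"
      by (rule arg_cong)
    moreover have "\<mu> * (1 + 2 * t * (w \<bullet> v) + t\<^sup>2 * (w \<bullet> w))
        \<le> \<mu> + 2 * t * (w \<bullet> (N *v v)) + t\<^sup>2 * ?q w"
      using rayleigh[of ?z] unfolding q z .
    ultimately show "0 \<le> 2 * t * (w \<bullet> w) + t\<^sup>2 * (?q w - \<mu> * (w \<bullet> w))"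
      by (simp add: algebra_simps)
  qed
  then have "N *v v = \<mu> *s v" by (simp add: w_def scalar_mult_eq_scaleR)
  moreover have "v \<noteq> 0" using vv by auto
  ultimately have "\<mu> \<in> eigenvalues N" by (auto simp: eigenvalues_def)
  then show thesis using rayleigh that by blast
qed

lemma transpose_gram: "transpose (transpose M ** M) = transpose M ** (M :: real ^ 'c ^ 'm)"
  by (simp add: matrix_transpose_mul)

lemma inner_gram:
  fixes M :: "real ^ 'c ^ 'm"
  shows "x \<bullet> ((transpose M ** M) *v y) = (M *v x) \<bullet> (M *v y)"
  by (metis inner_commute inner_transpose_mult matrix_vector_mul_assoc)

lemma finite_singular_values: "finite (singular_values M)"
  unfolding singular_values_def by (simp add: finite_eigenvalues_symmetric transpose_gram)

lemma sigma_min_mult_norm_le: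
  fixes M :: "real ^ 'c ^ 'm"
  shows "sigma_min M * norm x \<le> norm (M *v x)"
proof -
  obtain \<mu> where \<mu>: "\<mu> \<in> eigenvalues (transpose M ** M)"
    and rayleigh: "\<And>x. \<mu> * (x \<bullet> x) \<le> x \<bullet> ((transpose M ** M) *v x)"
    using symmetric_least_eigenvalue[OF transpose_gram[of M]] by blast
  have "sigma_min M \<le> sqrt \<mu>"
    unfolding sigma_min_def using \<mu>
    by (intro Min_le finite_singular_values) (simp add: singular_values_def)
  then have "sigma_min M * norm x \<le> sqrt \<mu> * norm x" by (rule mult_right_mono) simp
  also have "\<dots> = sqrt (\<mu> * (x \<bullet> x))" by (simp add: norm_eq_sqrt_inner real_sqrt_mult)
  also have "\<dots> \<le> norm (M *v x)"
    using rayleigh[of x] by (simp add: norm_eq_sqrt_inner inner_gram)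
  finally show ?thesis .
qed

lemma sigma_min_attained:
  fixes M :: "real ^ 'c ^ 'm"
  obtains v where "v \<noteq> 0" and "norm (M *v v) = sigma_min M * norm v"
proof -
  have "eigenvalues (transpose M ** M) \<noteq> {}"
    using symmetric_least_eigenvalue[OF transpose_gram[of M]] by blast
  then have "sigma_min M \<in> singular_values M"
    unfolding sigma_min_def by (intro Min_in finite_singular_values) (simp add: singular_values_def)
  then obtain l v where l: "sigma_min M = sqrt l" and "v \<noteq> 0"
    and v: "(transpose M ** M) *v v = l *s v"
    unfolding singular_values_def eigenvalues_def by auto
  have "(M *v v) \<bullet> (M *v v) = l * (v \<bullet> v)"
    using inner_gram[of v M v] by (simp add: v scalar_mult_eq_scaleR)
  then have "norm (M *v v) = sigma_min M * norm v"
    by (simp add: l norm_eq_sqrt_inner real_sqrt_mult)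
  then show thesis using \<open>v \<noteq> 0\<close> that by blast
qed

lemma sigma_min_nonneg: "0 \<le> sigma_min M"
proof -
  obtain v where "v \<noteq> 0" "norm (M *v v) = sigma_min M * norm v" by (rule sigma_min_attained)
  then have "0 \<le> sigma_min M * norm v" by (metis norm_ge_zero)
  then show ?thesis using \<open>v \<noteq> 0\<close> by (simp add: zero_le_mult_iff)
qed

lemma sigma_min_pos:
  fixes M :: "real ^ 'c ^ 'm"
  assumes full_rank: "rank M = CARD('c)"
  shows "0 < sigma_min M"
proof -
  obtain v where "v \<noteq> 0" and v: "norm (M *v v) = sigma_min M * norm v"
    by (rule sigma_min_attained)
  have "inj ((*v) M)" using full_rank by (simp add: full_rank_injective)
  then have "M *v v \<noteq> 0" using \<open>v \<noteq> 0\<close> by (metis injD matrix_vector_mult_0_right)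
  then have "sigma_min M \<noteq> 0" using v by auto
  then show ?thesis using sigma_min_nonneg[of M] by simp
qed

section \<open>Orthonormal columns and subsampling\<close>

lemma norm_orthonormal_columns_mult:
  fixes M :: "real ^ 'c ^ 'm"
  assumes "orthonormal_columns M"
  shows "norm (M *v x) = norm x"
proof -
  have "transpose M ** M = mat 1"
    using assms by (simp add: matrix_mult_transpose_dot_column orthonormal_columns_def mat_def)
  then show ?thesis using inner_gram[of x M x] by (simp add: norm_eq_sqrt_inner)
qed

lemma subsampling_mult_transpose:
  fixes S :: "real ^ 'n ^ 's"
  assumes "subsampling_matrix S"
  shows "S ** transpose S = mat 1"
proof -
  obtain f where "inj f" and f: "\<And>i. row i S = row (f i) (mat 1 :: real ^ 'n ^ 'n)"
    using assms by (auto simp: subsampling_matrix_def)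
  have "row i S = axis (f i) 1" for i
    unfolding f by (simp add: vec_eq_iff row_def mat_def axis_def)
  then have "row i S \<bullet> row j S = (if i = j then 1 else 0)" for i j
    using \<open>inj f\<close> by (auto simp: inner_axis_axis dest: injD)
  then show ?thesis by (simp add: matrix_mult_transpose_dot_row mat_def)
qed

text \<open>
  When the rows of \<open>S\<close> are orthonormal, \<open>transpose S ** S\<close> is an orthogonal projection, and this
  is Pythagoras for that projection and its complement.
\<close>

lemma inner_split_by_rows:
  fixes S :: "real ^ 'n ^ 's"
  assumes rows: "S ** transpose S = mat 1"
  shows "x \<bullet> y = (S *v x) \<bullet> (S *v y)
    + (x - transpose S *v (S *v x)) \<bullet> (y - transpose S *v (S *v y))"
proof -
  have "S *v (transpose S *v z) = z" for z
    by (simp add: matrix_vector_mul_assoc rows del: transpose_matrix_vector)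
  then have "(transpose S *v (S *v x)) \<bullet> (transpose S *v (S *v y)) = (S *v x) \<bullet> (S *v y)"
    by (simp add: inner_transpose_mult del: transpose_matrix_vector)
  moreover have "x \<bullet> (transpose S *v (S *v y)) = (S *v x) \<bullet> (S *v y)"
    by (metis inner_commute inner_transpose_mult)
  ultimately show ?thesis
    by (simp add: inner_diff_left inner_diff_right inner_transpose_mult
        del: transpose_matrix_vector)
qed

lemma norm_orthonormal_rows_mult_le:
  fixes S :: "real ^ 'n ^ 's"
  assumes "S ** transpose S = mat 1"
  shows "norm (S *v x) \<le> norm x"
proof -
  have "(S *v x) \<bullet> (S *v x) \<le> x \<bullet> x"
    by (metis inner_split_by_rows[OF assms] inner_ge_zero le_add_same_cancel1)
  then show ?thesis by (simp add: norm_le)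
qed

text \<open>
  With \<open>a\<close>, \<open>d\<close> the norms of the sampled and discarded parts of \<open>e\<close>, and \<open>\<rho>1\<close>, \<open>\<rho>2\<close> those of \<open>r\<close>, the
  second orthogonality relation gives \<open>a \<le> \<rho>1\<close>, and both together give \<open>a\<^sup>2 \<le> d * \<rho>2\<close>. Hence
  \<open>a\<^sup>2 * (a\<^sup>2 + d\<^sup>2) \<le> d\<^sup>2 * (\<rho>1\<^sup>2 + \<rho>2\<^sup>2)\<close>: a large error \<open>e\<close> forces \<open>r\<close> to be large in the discarded
  coordinates as well, which is what improves the factor \<open>sqrt (1 + 1 / \<kappa>\<^sup>2)\<close> to \<open>1 / \<kappa>\<close>.
\<close>

lemma oblique_residual_bound:
  fixes S :: "real ^ 'n ^ 's"
  assumes rows: "S ** transpose S = mat 1"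
    and orth: "e \<bullet> r = 0"
    and sampled_orth: "(S *v e) \<bullet> (S *v (e + r)) = 0"
    and "0 < \<kappa>" "\<kappa> \<le> 1"
    and lower: "\<kappa> * norm e \<le> norm (S *v e)"
  shows "\<kappa> * norm (e + r) \<le> norm r"
proof -
  define T where "T x = x - transpose S *v (S *v x)" for x
  define a d \<rho>1 \<rho>2 where "a = norm (S *v e)" and "d = norm (T e)"
    and "\<rho>1 = norm (S *v r)" and "\<rho>2 = norm (T r)"
  have split: "x \<bullet> y = (S *v x) \<bullet> (S *v y) + T x \<bullet> T y" for x y
    unfolding T_def by (rule inner_split_by_rows[OF rows])
  have norm_e: "(norm e)\<^sup>2 = a\<^sup>2 + d\<^sup>2" and norm_r: "(norm r)\<^sup>2 = \<rho>1\<^sup>2 + \<rho>2\<^sup>2"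
    using split[of e e] split[of r r] by (simp_all add: a_def d_def \<rho>1_def \<rho>2_def dot_square_norm)
  have aa: "a\<^sup>2 = - ((S *v e) \<bullet> (S *v r))"
    using sampled_orth
    by (simp add: a_def matrix_vector_right_distrib inner_add_right dot_square_norm[symmetric])
  have "a\<^sup>2 \<le> a * \<rho>1"
    unfolding aa using norm_cauchy_schwarz[of "- (S *v e)" "S *v r"] by (simp add: a_def \<rho>1_def)
  then have "a \<le> \<rho>1"
    by (cases "a = 0") (auto simp: a_def \<rho>1_def power2_eq_square)
  then have "a\<^sup>2 \<le> \<rho>1\<^sup>2" by (simp add: a_def power_mono)
  then have 1: "d\<^sup>2 * a\<^sup>2 \<le> d\<^sup>2 * \<rho>1\<^sup>2" by (rule mult_left_mono) simp
  have "a\<^sup>2 = T e \<bullet> T r" using aa split[of e r] orth by simp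
  then have "a\<^sup>2 \<le> d * \<rho>2" using norm_cauchy_schwarz[of "T e" "T r"] by (simp add: d_def \<rho>2_def)
  then have "(a\<^sup>2)\<^sup>2 \<le> (d * \<rho>2)\<^sup>2" by (rule power_mono) simp
  with 1 have key: "a\<^sup>2 * (norm e)\<^sup>2 \<le> d\<^sup>2 * (norm r)\<^sup>2"
    unfolding norm_e norm_r by (simp add: power2_eq_square algebra_simps)
  have \<kappa>2: "\<kappa>\<^sup>2 \<le> 1" using \<open>0 < \<kappa>\<close> \<open>\<kappa> \<le> 1\<close> by (simp add: power_le_one)
  have "(\<kappa> * norm e)\<^sup>2 \<le> a\<^sup>2"
    using lower \<open>0 < \<kappa>\<close> by (intro power_mono) (auto simp: a_def)
  then have a_lower: "\<kappa>\<^sup>2 * (norm e)\<^sup>2 \<le> a\<^sup>2" by (simp add: power_mult_distrib)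
  have "\<kappa>\<^sup>2 * (norm e)\<^sup>2 \<le> (1 - \<kappa>\<^sup>2) * (norm r)\<^sup>2"
  proof (cases "e = 0")
    case True
    then show ?thesis using \<kappa>2 by simp
  next
    case False
    \<comment> \<open>Insert the lower bound on \<open>a\<close> on the left of \<open>key\<close>, the resulting upper bound on \<open>d\<close> on
      the right, and cancel one factor \<open>(norm e)\<^sup>2\<close>.\<close>
    have "(\<kappa>\<^sup>2 * (norm e)\<^sup>2) * (norm e)\<^sup>2 \<le> a\<^sup>2 * (norm e)\<^sup>2"
      using a_lower by (rule mult_right_mono) simp
    also note key
    also have "d\<^sup>2 \<le> (1 - \<kappa>\<^sup>2) * (norm e)\<^sup>2"
      using a_lower norm_e by (simp add: algebra_simps)
    then have "d\<^sup>2 * (norm r)\<^sup>2 \<le> ((1 - \<kappa>\<^sup>2) * (norm e)\<^sup>2) * (norm r)\<^sup>2"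
      by (rule mult_right_mono) simp
    finally have "(\<kappa>\<^sup>2 * (norm e)\<^sup>2) * (norm e)\<^sup>2 \<le> ((1 - \<kappa>\<^sup>2) * (norm r)\<^sup>2) * (norm e)\<^sup>2"
      by (simp add: mult_ac)
    then show ?thesis using False by simp
  qed
  moreover have "(norm (e + r))\<^sup>2 = (norm e)\<^sup>2 + (norm r)\<^sup>2"
    using orth
    by (simp add: dot_square_norm[symmetric] inner_add_left inner_add_right inner_commute)
  ultimately have "(\<kappa> * norm (e + r))\<^sup>2 \<le> (norm r)\<^sup>2"
    by (simp add: power_mult_distrib algebra_simps)
  then show ?thesis by (rule power2_le_imp_le) simp
qed

section \<open>Sampling least-squares problems\<close>

lemma sampled_least_squares_bound:
  fixes S :: "real ^ 'n ^ 's" and B :: "real ^ 'r ^ 'n"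
  assumes rows: "S ** transpose S = mat 1"
    and opt: "\<And>x. norm (B *v c - b) \<le> norm (B *v x - b)"
    and sampled_opt: "\<And>x. norm (S *v (B *v c' - b)) \<le> norm (S *v (B *v x - b))"
    and "0 < \<kappa>" "\<kappa> \<le> 1"
    and lower: "\<And>x. \<kappa> * norm (B *v x) \<le> norm (S *v (B *v x))"
  shows "\<kappa> * norm (B *v c' - b) \<le> norm (B *v c - b)"
proof -
  let ?e = "B *v (c' - c)" and ?r = "B *v c - b"
  have sum: "B *v c' - b = ?e + ?r" by (simp add: matrix_vector_mult_diff_distrib)
  have "?e \<bullet> ?r = 0"
    using least_squares_orthogonal[OF opt, of "c' - c"] by (simp add: inner_commute)
  moreover have "(S *v ?e) \<bullet> (S *v (?e + ?r)) = 0"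
  proof -
    have "norm ((S ** B) *v c' - S *v b) \<le> norm ((S ** B) *v x - S *v b)" for x
      using sampled_opt[of x]
      by (simp add: matrix_vector_mult_diff_distrib matrix_vector_mul_assoc)
    from least_squares_orthogonal[OF this, of "c' - c"] show ?thesis
      unfolding sum[symmetric]
      by (simp add: matrix_vector_mult_diff_distrib matrix_vector_mul_assoc inner_commute)
  qed
  ultimately show ?thesis
    unfolding sum by (intro oblique_residual_bound[OF rows]) (use assms in auto)
qed

lemma sigma_min_orthonormal_le_one:
  fixes S :: "real ^ 'n ^ 's" and U :: "real ^ 'r ^ 'n"
  assumes "S ** transpose S = mat 1" and "orthonormal_columns U"
  shows "sigma_min (S ** U) \<le> 1"
proof -
  let ?x = "axis undefined 1 :: real ^ 'r"
  have "sigma_min (S ** U) * norm ?x \<le> norm (S *v (U *v ?x))"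
    using sigma_min_mult_norm_le[of "S ** U" ?x] by (simp add: matrix_vector_mul_assoc)
  also have "\<dots> \<le> norm ?x"
    using norm_orthonormal_rows_mult_le[OF assms(1), of "U *v ?x"]
    by (simp add: norm_orthonormal_columns_mult[OF assms(2)])
  finally show ?thesis by simp
qed

text \<open>
  The constant \<open>3\<close> arises here: two perturbation errors, one in the sampled and one in the full
  vector, are measured relative to \<open>\<sigma> - \<delta>\<close>, and \<open>3 * \<delta> \<le> \<sigma>\<close> turns \<open>2 / (\<sigma> - \<delta>)\<close> into \<open>3 / \<sigma>\<close>.
\<close>

lemma sampling_lower_bound_perturbed:
  fixes S :: "real ^ 'n ^ 's" and B B0 U :: "real ^ 'r ^ 'n" and H :: "real ^ 'r ^ 'r"
  assumes rows: "S ** transpose S = mat 1"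
    and cols: "orthonormal_columns U" and polar: "B0 = U ** H"
    and near: "\<And>x. norm (B *v x - B0 *v x) \<le> \<delta> * norm x"
    and "0 \<le> \<delta>" and \<sigma>: "0 < sigma_min B0" "3 * \<delta> \<le> sigma_min B0"
  shows "(sigma_min (S ** U) - 3 / sigma_min B0 * \<delta>) * norm (B *v x) \<le> norm (S *v (B *v x))"
proof -
  let ?m = "sigma_min (S ** U)" and ?\<sigma> = "sigma_min B0"
  let ?y = "B *v x" and ?z = "B0 *v x"
  have m1: "?m \<le> 1" using rows cols by (rule sigma_min_orthonormal_le_one)
  have "norm ?z = norm (H *v x)"
    by (simp add: polar matrix_vector_mul_assoc[symmetric] norm_orthonormal_columns_mult[OF cols])
  moreover have "?m * norm (H *v x) \<le> norm (S *v ?z)"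
    using sigma_min_mult_norm_le[of "S ** U" "H *v x"]
    by (simp add: polar matrix_vector_mul_assoc matrix_mul_assoc)
  ultimately have y0: "?m * norm ?z \<le> norm (S *v ?z)" by simp
  have "norm (S *v ?z) - norm (S *v ?y) \<le> norm (S *v (?z - ?y))"
    by (simp add: matrix_vector_mult_diff_distrib norm_triangle_ineq2)
  also have "\<dots> \<le> norm (?z - ?y)" using rows by (rule norm_orthonormal_rows_mult_le)
  also have "\<dots> \<le> \<delta> * norm x" using near[of x] by (simp add: norm_minus_commute)
  finally have Sy: "norm (S *v ?z) - \<delta> * norm x \<le> norm (S *v ?y)" by simp
  have yy0: "\<bar>norm ?y - norm ?z\<bar> \<le> \<delta> * norm x"
    using norm_triangle_ineq3[of ?y ?z] near[of x] by linarith
  have "norm ?z \<ge> ?\<sigma> * norm x" by (rule sigma_min_mult_norm_le)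
  then have "(?\<sigma> - \<delta>) * norm x \<le> norm ?y" using yy0 by (simp add: algebra_simps abs_le_iff)
  moreover have "2 * ?\<sigma> / 3 * norm x \<le> (?\<sigma> - \<delta>) * norm x"
    using \<sigma> by (intro mult_right_mono) auto
  ultimately have "2 * norm x \<le> 3 / ?\<sigma> * norm ?y" using \<sigma> by (simp add: field_simps)
  then have "\<delta> * (2 * norm x) \<le> \<delta> * (3 / ?\<sigma> * norm ?y)"
    using \<open>0 \<le> \<delta>\<close> by (rule mult_left_mono)
  moreover have "?m * (norm ?y - norm ?z) \<le> \<delta> * norm x"
  proof -
    have "?m * (norm ?y - norm ?z) \<le> ?m * (\<delta> * norm x)"
      using yy0 sigma_min_nonneg by (intro mult_left_mono) auto
    also have "\<dots> \<le> 1 * (\<delta> * norm x)" using m1 \<open>0 \<le> \<delta>\<close> by (intro mult_right_mono) auto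
    finally show ?thesis by simp
  qed
  ultimately show ?thesis using y0 Sy by (simp add: algebra_simps)
qed

lemma sampled_residual_near_polar:
  fixes S :: "real ^ 'n ^ 's" and B B0 U :: "real ^ 'r ^ 'n" and H :: "real ^ 'r ^ 'r"
    and \<delta> :: real
  defines "\<kappa> \<equiv> sigma_min (S ** U) - 3 / sigma_min B0 * \<delta>"
  assumes rows: "S ** transpose S = mat 1"
    and cols: "orthonormal_columns U" and polar: "B0 = U ** H" and \<sigma>: "0 < sigma_min B0"
    and near: "\<And>x. norm (B *v x - B0 *v x) \<le> \<delta> * norm x" and "0 \<le> \<delta>" and "0 < \<kappa>"
    and opt: "\<And>x. norm (B *v c - b) \<le> norm (B *v x - b)"
    and sampled_opt: "\<And>x. norm (S *v (B *v c' - b)) \<le> norm (S *v (B *v x - b))"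
  shows "\<kappa> * norm (B *v c' - b) \<le> norm (B *v c - b)"
proof -
  have m1: "sigma_min (S ** U) \<le> 1" using rows cols by (rule sigma_min_orthonormal_le_one)
  then have "3 / sigma_min B0 * \<delta> < 1" using \<open>0 < \<kappa>\<close> by (simp add: \<kappa>_def)
  then have "3 * \<delta> \<le> sigma_min B0" using \<sigma> by (simp add: field_simps)
  then have lower: "\<kappa> * norm (B *v x) \<le> norm (S *v (B *v x))" for x
    unfolding \<kappa>_def
    using sampling_lower_bound_perturbed[OF rows cols polar near \<open>0 \<le> \<delta>\<close> \<sigma>] by blast
  have "0 \<le> 3 / sigma_min B0 * \<delta>" using \<open>0 \<le> \<delta>\<close> \<sigma> by simp
  then have "\<kappa> \<le> 1" using m1 by (simp add: \<kappa>_def)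
  show ?thesis
    by (rule sampled_least_squares_bound[OF rows opt sampled_opt \<open>0 < \<kappa>\<close> \<open>\<kappa> \<le> 1\<close> lower])
qed

lemma ratio_le_inverseI:
  assumes "0 < \<kappa>" and "\<kappa> * x \<le> y" and "0 \<le> y"
  shows "ratio_le x y (1 / \<kappa>)"
proof (cases "y = 0")
  case True
  then show ?thesis using assms by (simp add: ratio_le_def mult_le_0_iff)
next
  case False
  then show ?thesis using assms by (simp add: ratio_le_def field_simps)
qed

section \<open>Residual bounds from the snapshots\<close>

theorem corollary5p3:
  fixes \<Omega> :: "(real ^ 'd) set"
    and A :: "real ^ 'd \<Rightarrow> real ^ 'n ^ 'n"
    and b :: "real ^ 'd \<Rightarrow> real ^ 'n"
    and snap :: "'r::finite \<Rightarrow> real ^ 'd"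
    and Q :: "real ^ 'r ^ 'n"
    and B :: "real ^ 'd \<Rightarrow> real ^ 'r ^ 'n"
    and S :: "real ^ 'n ^ 's"
    and U :: "real ^ 'd \<Rightarrow> real ^ 'r ^ 'n"
    and H :: "real ^ 'd \<Rightarrow> real ^ 'r ^ 'r"
    and c c_hat :: "real ^ 'd \<Rightarrow> real ^ 'r"
    and L :: real
  assumes "CARD('r) \<le> CARD('n)" and "CARD('r) \<le> CARD('s)" and "CARD('s) < CARD('n)"
    and "bounded \<Omega>"
    and "\<And>i. snap i \<in> \<Omega>"
    and "orthonormal_columns Q"
    and "\<And>p. p \<in> \<Omega> \<Longrightarrow> B p = A p ** Q"
    and "subsampling_matrix S"
    and "\<And>i. rank (A (snap i) ** Q) = CARD('r)"
    and "\<And>i. polar_decomposition (A (snap i) ** Q) (U (snap i)) (H (snap i))"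
    and "\<And>p. p \<in> \<Omega> \<Longrightarrow> is_arg_min (\<lambda>x. norm (B p *v x - b p)) (\<lambda>x. True) (c p)"
    and "\<And>p. p \<in> \<Omega> \<Longrightarrow> is_arg_min (\<lambda>x. norm (S *v (B p *v x - b p))) (\<lambda>x. True) (c_hat p)"
    and "0 \<le> L"
    and "\<And>p q. p \<in> \<Omega> \<Longrightarrow> q \<in> \<Omega> \<Longrightarrow> opnorm (A p - A q) \<le> L * norm (p - q)"
  shows
    "(\<forall>p\<in>\<Omega>. \<forall>i. is_arg_min (\<lambda>j. norm (p - snap j)) (\<lambda>j. True) i \<longrightarrow>
        (let \<delta> = L * norm (p - snap i);
             C = 3 / sigma_min (A (snap i) ** Q)
         in sigma_min (S ** U (snap i)) > C * \<delta> \<longrightarrow>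
            ratio_le (norm (B p *v c_hat p - b p)) (norm (B p *v c p - b p))
              (1 / (sigma_min (S ** U (snap i)) - C * \<delta>))))
     \<and>
     (\<forall>h. (\<forall>p\<in>\<Omega>. Min (range (\<lambda>i. norm (p - snap i))) \<le> h) \<longrightarrow>
        (\<forall>p\<in>\<Omega>.
          let \<delta> = L * h;
              C = 3 / Min (range (\<lambda>i. sigma_min (A (snap i) ** Q)));
              m = Min (range (\<lambda>i. sigma_min (S ** U (snap i))))
          in m > C * \<delta> \<longrightarrow>
             ratio_le (norm (B p *v c_hat p - b p)) (norm (B p *v c p - b p))
               (1 / (m - C * \<delta>))))"
proof -
  note snap = assms(5) and Bp = assms(7) and rank = assms(9) and polar = assms(10)
    and opt = assms(11) and sampled_opt = assms(12) and lipschitz = assms(14)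
  have rows: "S ** transpose S = mat 1" using assms(8) by (rule subsampling_mult_transpose)
  have \<sigma>_pos: "0 < sigma_min (A (snap i) ** Q)" for i using rank by (rule sigma_min_pos)
  define \<delta> where "\<delta> p i = L * norm (p - snap i)" for p i
  define \<kappa> where "\<kappa> p i = sigma_min (S ** U (snap i)) - 3 / sigma_min (A (snap i) ** Q) * \<delta> p i"
    for p i
  have \<delta>_nonneg: "0 \<le> \<delta> p i" for p i using \<open>0 \<le> L\<close> by (simp add: \<delta>_def)
  have near: "norm (B p *v x - (A (snap i) ** Q) *v x) \<le> \<delta> p i * norm x" if "p \<in> \<Omega>" for p i x
  proof -
    have "B p *v x - (A (snap i) ** Q) *v x = (A p - A (snap i)) *v (Q *v x)"
      by (simp add: Bp that matrix_vector_mul_assoc[symmetric] matrix_vector_mult_diff_rdistrib)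
    also have "norm \<dots> \<le> opnorm (A p - A (snap i)) * norm (Q *v x)"
      unfolding opnorm_def by (intro onorm matrix_vector_mul_bounded_linear)
    also have "\<dots> \<le> \<delta> p i * norm (Q *v x)"
      unfolding \<delta>_def using lipschitz[OF that snap] by (rule mult_right_mono) simp
    finally show ?thesis by (simp add: norm_orthonormal_columns_mult[OF assms(6)])
  qed
  have bound: "\<kappa> p i * norm (B p *v c_hat p - b p) \<le> norm (B p *v c p - b p)"
    if p: "p \<in> \<Omega>" and "0 < \<kappa> p i" for p i
    unfolding \<kappa>_def
  proof (rule sampled_residual_near_polar[OF rows _ _ \<sigma>_pos near[OF p] \<delta>_nonneg])
    show "orthonormal_columns (U (snap i))" "A (snap i) ** Q = U (snap i) ** H (snap i)"
      using polar[of i] by (auto simp: polar_decomposition_def)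
    show "0 < sigma_min (S ** U (snap i)) - 3 / sigma_min (A (snap i) ** Q) * \<delta> p i"
      using \<open>0 < \<kappa> p i\<close> by (simp add: \<kappa>_def)
    show "norm (B p *v c p - b p) \<le> norm (B p *v x - b p)" for x
      using opt[OF p] by (auto simp: is_arg_min_linorder)
    show "norm (S *v (B p *v c_hat p - b p)) \<le> norm (S *v (B p *v x - b p))" for x
      using sampled_opt[OF p] by (auto simp: is_arg_min_linorder)
  qed
  show ?thesis
    unfolding Let_def
  proof (intro conjI allI ballI impI)
    fix p i
    assume "p \<in> \<Omega>"
      and "3 / sigma_min (A (snap i) ** Q) * (L * norm (p - snap i)) < sigma_min (S ** U (snap i))"
    then show "ratio_le (norm (B p *v c_hat p - b p)) (norm (B p *v c p - b p))
        (1 / (sigma_min (S ** U (snap i))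
          - 3 / sigma_min (A (snap i) ** Q) * (L * norm (p - snap i))))"
      using bound[of p i] by (intro ratio_le_inverseI) (auto simp: \<kappa>_def \<delta>_def)
  next
    fix h p
    let ?\<sigma> = "Min (range (\<lambda>i. sigma_min (A (snap i) ** Q)))"
    let ?m = "Min (range (\<lambda>i. sigma_min (S ** U (snap i))))"
    assume fill: "\<forall>p\<in>\<Omega>. Min (range (\<lambda>i. norm (p - snap i))) \<le> h" and p: "p \<in> \<Omega>"
      and pos: "3 / ?\<sigma> * (L * h) < ?m"
    have "Min (range (\<lambda>i. norm (p - snap i))) \<in> range (\<lambda>i. norm (p - snap i))"
      by (rule Min_in) auto
    then obtain i where "Min (range (\<lambda>i. norm (p - snap i))) = norm (p - snap i)" by blast
    then have "norm (p - snap i) \<le> h" using fill p by metis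
    then have "\<delta> p i \<le> L * h" unfolding \<delta>_def using \<open>0 \<le> L\<close> by (rule mult_left_mono)
    have "?\<sigma> \<in> range (\<lambda>i. sigma_min (A (snap i) ** Q))" by (rule Min_in) auto
    then have "0 < ?\<sigma>" using \<sigma>_pos by auto
    moreover have "?\<sigma> \<le> sigma_min (A (snap i) ** Q)" by (rule Min_le) auto
    ultimately have "3 / sigma_min (A (snap i) ** Q) \<le> 3 / ?\<sigma>" by (intro divide_left_mono) auto
    then have "3 / sigma_min (A (snap i) ** Q) * \<delta> p i \<le> 3 / ?\<sigma> * (L * h)"
      using \<open>\<delta> p i \<le> L * h\<close> \<open>0 < ?\<sigma>\<close> by (intro mult_mono \<delta>_nonneg) (auto intro: less_imp_le)
    moreover have "?m \<le> sigma_min (S ** U (snap i))" by (rule Min_le) auto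
    ultimately have \<kappa>: "?m - 3 / ?\<sigma> * (L * h) \<le> \<kappa> p i" unfolding \<kappa>_def by linarith
    then have "(?m - 3 / ?\<sigma> * (L * h)) * norm (B p *v c_hat p - b p)
        \<le> \<kappa> p i * norm (B p *v c_hat p - b p)"
      by (rule mult_right_mono) simp
    also have "\<dots> \<le> norm (B p *v c p - b p)" using \<kappa> pos by (intro bound p) linarith
    finally show "ratio_le (norm (B p *v c_hat p - b p)) (norm (B p *v c p - b p))
        (1 / (?m - 3 / ?\<sigma> * (L * h)))"
      using pos by (intro ratio_le_inverseI) auto
  qed
qed

end
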